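(* Let $I$ be a set and let $F:\mathsf{P}_+^I\to\mathsf{P}_+$ be a function (i.e. $F:[0,+\infty]^I\to[0,+\infty]$). The following statements are equivalent: (1) $F$ is an extended quasi-pseudometric aggregation function on products; (2) $F$ is an extended quasi-pseudometric aggregation function on sets; (3) $F$ is a lax morphism of quantales; (4) $F$ preserves asymmetric triangle triplets and $F((0)_{i\in I})=0$.
   Context: $\mathsf{P}_+=([0,+\infty],\leq^{\mathrm{op}},+)$ is the Lawvere quantale, where $x\leq^{\mathrm{op}}y$ iff $y\leq x$; its unit (and top element) is $0$. $\mathsf{P}_+^I$ is $[0,+\infty]^I$ with componentwise order $\leq^{\mathrm{op}}$ and componentwise addition; its unit is $(0)_{i\in I}$. A map $F:(\mathscr{V},\preceq,\ast)\to(\mathscr{W},\curlyeqprec,\star)$ between quantales with units $1_\mathscr{V},1_\mathscr{W}$ is a *lax morphism of quantales* if: $u\preceq v$ implies $F(u)\curlyeqprec F(v)$; $1_\mathscr{W}\curlyeqprec F(1_\mathscr{V})$; and $F(u)\star F(v)\curlyeqprec F(u\ast v)$ for all $u,v\in\mathscr{V}$. A triplet $(u,v,w)$ of elements of a quantale $(\mathscr{V},\preceq,\ast)$ is an *asymmetric triangle triplet* if $u\ast v\preceq w$; thus in $\mathsf{P}_+^I$ and $\mathsf{P}_+$ this means $w\leq u+v$ for the usual (componentwise) order. $F$ *preserves asymmetric triangle triplets* if it maps each asymmetric triangle triplet $(u,v,w)$ to an asymmetric triangle triplet $(F(u),F(v),F(w))$. An extended quasi-pseudometric on a nonempty set $X$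 is a map $d:X\times X\to[0,+\infty]$ with $d(x,x)=0$ and $d(x,y)\leq d(x,z)+d(z,y)$ for all $x,y,z\in X$. $F:[0,+\infty]^I\to[0,+\infty]$ is an *extended quasi-pseudometric aggregation function on products* if for every family $\{(X_i,d_i):i\in I\}$ of extended quasi-pseudometric spaces, $(x,y)\mapsto F((d_i(x_i,y_i))_{i\in I})$ is an extended quasi-pseudometric on $\prod_{i\in I}X_i$. It is an *extended quasi-pseudometric aggregation function on sets* if for every nonempty set $X$ and every family $\{d_i:i\in I\}$ of extended quasi-pseudometrics on $X$, $(x,y)\mapsto F((d_i(x,y))_{i\in I})$ is an extended quasi-pseudometric on $X$. *)

theory Defs
  imports "HOL-Algebra.Complete_Lattice" "HOL-Algebra.Group"
    "HOL-Analysis.Extended_Real_Limits"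
begin

section \<open>Quantales\<close>

record 'a quantale = "'a monoid" +
  qle :: "['a, 'a] \<Rightarrow> bool" (infixl \<open>\<preceq>\<index>\<close> 50)

definition order_of :: "('a, 'b) quantale_scheme \<Rightarrow> 'a gorder" where
  "order_of V = \<lparr>carrier = carrier V, eq = (=), le = qle V\<rparr>"

locale quantale = monoid V + order: complete_lattice "order_of V" for V (structure) +
  assumes mult_lub_left:
    "\<lbrakk>x \<in> carrier V; A \<subseteq> carrier V; is_lub (order_of V) s A\<rbrakk>
      \<Longrightarrow> is_lub (order_of V) (x \<otimes> s) ((\<lambda>a. x \<otimes> a) ` A)"
  and mult_lub_right:
    "\<lbrakk>x \<in> carrier V; A \<subseteq> carrier V; is_lub (order_of V) s A\<rbrakk>
      \<Longrightarrow> is_lub (order_of V) (s \<otimes> x) ((\<lambda>a. a \<otimes> x) ` A)"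

locale lax_morphism = V: quantale V + W: quantale W
  for V :: "('a, 'c) quantale_scheme" and W :: "('b, 'd) quantale_scheme"
    and F :: "'a \<Rightarrow> 'b" +
  assumes maps_to: "F \<in> carrier V \<rightarrow> carrier W"
    and mono: "\<lbrakk>u \<in> carrier V; v \<in> carrier V; u \<preceq>\<^bsub>V\<^esub> v\<rbrakk> \<Longrightarrow> F u \<preceq>\<^bsub>W\<^esub> F v"
    and lax_one: "\<one>\<^bsub>W\<^esub> \<preceq>\<^bsub>W\<^esub> F \<one>\<^bsub>V\<^esub>"
    and lax_mult: "\<lbrakk>u \<in> carrier V; v \<in> carrier V\<rbrakk> \<Longrightarrow> F u \<otimes>\<^bsub>W\<^esub> F v \<preceq>\<^bsub>W\<^esub> F (u \<otimes>\<^bsub>V\<^esub> v)"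

definition asymmetric_triangle_triplet :: "('a, 'c) quantale_scheme \<Rightarrow> 'a \<Rightarrow> 'a \<Rightarrow> 'a \<Rightarrow> bool" where
  "asymmetric_triangle_triplet V u v w \<longleftrightarrow>
     u \<in> carrier V \<and> v \<in> carrier V \<and> w \<in> carrier V \<and> u \<otimes>\<^bsub>V\<^esub> v \<preceq>\<^bsub>V\<^esub> w"

definition preserves_asymmetric_triangle_triplets ::
  "('a, 'c) quantale_scheme \<Rightarrow> ('b, 'd) quantale_scheme \<Rightarrow> ('a \<Rightarrow> 'b) \<Rightarrow> bool" where
  "preserves_asymmetric_triangle_triplets V W F \<longleftrightarrow>
     (\<forall>u v w. asymmetric_triangle_triplet V u v w \<longrightarrow>
        asymmetric_triangle_triplet W (F u) (F v) (F w))"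

definition P_plus :: "ennreal quantale" (\<open>P\<^sub>+\<close>) where
  "P\<^sub>+ = \<lparr>carrier = UNIV, mult = (+), one = 0, qle = (\<ge>)\<rparr>"

text \<open>Elements of the power are extensional functions on \<open>I\<close>; the index set may be empty.\<close>

definition quantale_power :: "('a, 'c) quantale_scheme \<Rightarrow> 'i set \<Rightarrow> ('i \<Rightarrow> 'a) quantale" where
  "quantale_power V I =
     \<lparr>carrier = (\<Pi>\<^sub>E i\<in>I. carrier V),
      mult = (\<lambda>u v. \<lambda>i\<in>I. u i \<otimes>\<^bsub>V\<^esub> v i),
      one = (\<lambda>i\<in>I. \<one>\<^bsub>V\<^esub>),
      qle = (\<lambda>u v. \<forall>i\<in>I. u i \<preceq>\<^bsub>V\<^esub> v i)\<rparr>"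

section \<open>Aggregation of extended quasi-pseudometrics\<close>

definition ext_quasi_pseudometric :: "'a set \<Rightarrow> ('a \<Rightarrow> 'a \<Rightarrow> ennreal) \<Rightarrow> bool" where
  "ext_quasi_pseudometric X d \<longleftrightarrow>
     X \<noteq> {} \<and> (\<forall>x\<in>X. d x x = 0) \<and> (\<forall>x\<in>X. \<forall>y\<in>X. \<forall>z\<in>X. d x y \<le> d x z + d z y)"

text \<open>
  The type argument supplies the universe from which the points of all the spaces are drawn: a
  space is a subset of \<open>'a\<close>. A set-indexed family of spaces always lies in one common universe,
  e.g. through its disjoint union. A universe with fewer than three points cannot test the triangle
  inequality, so statements quantifying over all spaces should assume at least three.
\<close>

definition aggregation_on_products ::
  "'a itself \<Rightarrow> 'i set \<Rightarrow> (('i \<Rightarrow> ennreal) \<Rightarrow> ennreal) \<Rightarrow> bool" where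
  "aggregation_on_products (_ :: 'a itself) I F \<longleftrightarrow>
     (\<forall>(X :: 'i \<Rightarrow> 'a set) d. (\<forall>i\<in>I. ext_quasi_pseudometric (X i) (d i)) \<longrightarrow>
        ext_quasi_pseudometric (\<Pi>\<^sub>E i\<in>I. X i) (\<lambda>x y. F (\<lambda>i\<in>I. d i (x i) (y i))))"

definition aggregation_on_sets ::
  "'a itself \<Rightarrow> 'i set \<Rightarrow> (('i \<Rightarrow> ennreal) \<Rightarrow> ennreal) \<Rightarrow> bool" where
  "aggregation_on_sets (_ :: 'a itself) I F \<longleftrightarrow>
     (\<forall>(X :: 'a set) d. X \<noteq> {} \<longrightarrow> (\<forall>i\<in>I. ext_quasi_pseudometric X (d i)) \<longrightarrow>
        ext_quasi_pseudometric X (\<lambda>x y. F (\<lambda>i\<in>I. d i x y)))"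

section \<open>The two quantales of interest\<close>

lemma is_lub_order_of:
  "is_lub (order_of V) s A \<longleftrightarrow> s \<in> carrier V \<and> (\<forall>a\<in>A \<inter> carrier V. a \<preceq>\<^bsub>V\<^esub> s) \<and>
     (\<forall>b\<in>carrier V. (\<forall>a\<in>A \<inter> carrier V. a \<preceq>\<^bsub>V\<^esub> b) \<longrightarrow> s \<preceq>\<^bsub>V\<^esub> b)"
  unfolding least_def Upper_def order_of_def by auto

lemma is_glb_order_of:
  "is_glb (order_of V) s A \<longleftrightarrow> s \<in> carrier V \<and> (\<forall>a\<in>A \<inter> carrier V. s \<preceq>\<^bsub>V\<^esub> a) \<and>
     (\<forall>b\<in>carrier V. (\<forall>a\<in>A \<inter> carrier V. b \<preceq>\<^bsub>V\<^esub> a) \<longrightarrow> b \<preceq>\<^bsub>V\<^esub> s)"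
  unfolding greatest_def Lower_def order_of_def by auto

lemma quantaleI:
  assumes "monoid V"
    and refl: "\<And>x. x \<in> carrier V \<Longrightarrow> x \<preceq>\<^bsub>V\<^esub> x"
    and antisym: "\<And>x y. \<lbrakk>x \<in> carrier V; y \<in> carrier V; x \<preceq>\<^bsub>V\<^esub> y; y \<preceq>\<^bsub>V\<^esub> x\<rbrakk> \<Longrightarrow> x = y"
    and trans: "\<And>x y z. \<lbrakk>x \<in> carrier V; y \<in> carrier V; z \<in> carrier V; x \<preceq>\<^bsub>V\<^esub> y; y \<preceq>\<^bsub>V\<^esub> z\<rbrakk> \<Longrightarrow> x \<preceq>\<^bsub>V\<^esub> z"
    and lub: "\<And>A. A \<subseteq> carrier V \<Longrightarrow> \<exists>s. is_lub (order_of V) s A"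
    and glb: "\<And>A. A \<subseteq> carrier V \<Longrightarrow> \<exists>s. is_glb (order_of V) s A"
    and left: "\<And>x A s. \<lbrakk>x \<in> carrier V; A \<subseteq> carrier V; is_lub (order_of V) s A\<rbrakk>
      \<Longrightarrow> is_lub (order_of V) (x \<otimes>\<^bsub>V\<^esub> s) ((\<lambda>a. x \<otimes>\<^bsub>V\<^esub> a) ` A)"
    and right: "\<And>x A s. \<lbrakk>x \<in> carrier V; A \<subseteq> carrier V; is_lub (order_of V) s A\<rbrakk>
      \<Longrightarrow> is_lub (order_of V) (s \<otimes>\<^bsub>V\<^esub> x) ((\<lambda>a. a \<otimes>\<^bsub>V\<^esub> x) ` A)"
  shows "quantale V"
proof -
  interpret monoid V by fact
  have c: "carrier (order_of V) = carrier V" and e: "eq (order_of V) = (=)"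
    and l: "le (order_of V) = qle V"
    by (simp_all add: order_of_def)
  interpret complete_lattice "order_of V"
    by unfold_locales (auto simp: c e l intro: refl antisym lub glb dest: trans)
  show ?thesis
    by unfold_locales (fact left right)+
qed

lemma quantale_P_plus: "quantale P\<^sub>+"
proof -
  have lub: "is_lub (order_of P\<^sub>+) s A \<longleftrightarrow> s = Inf A" for s A
    unfolding is_lub_order_of
    by (auto simp: P_plus_def intro: Inf_lower Inf_greatest antisym)
  have glb: "\<exists>s. is_glb (order_of P\<^sub>+) s A" for A
    unfolding is_glb_order_of by (rule exI[of _ "Sup A"]) (auto simp: P_plus_def Sup_upper Sup_least)
  have dist: "x + Inf A = (INF a\<in>A. x + a)" for x :: ennreal and A
  proof (rule antisym)
    show "x + Inf A \<le> (INF a\<in>A. x + a)"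
      by (auto intro!: INF_greatest add_left_mono Inf_lower)
    show "(INF a\<in>A. x + a) \<le> x + Inf A"
    proof (cases "x = Orderings.top")
      case False
      have "(INF a\<in>A. x + a) - x \<le> Inf A"
        by (rule Inf_greatest) (auto simp: ennreal_minus_le_iff False intro: INF_lower)
      then show ?thesis by (simp add: ennreal_minus_le_iff)
    qed simp
  qed
  show ?thesis
  proof (rule quantaleI)
    show "monoid P\<^sub>+"
      by unfold_locales (auto simp: P_plus_def ac_simps)
  qed (auto simp: lub glb dist, auto simp: P_plus_def dist add.commute)
qed

lemma quantale_quantale_power:
  assumes "quantale V"
  shows "quantale (quantale_power V I)"
proof -
  interpret quantale V by fact
  let ?P = "quantale_power V I"
  have c: "carrier ?P = (\<Pi>\<^sub>E i\<in>I. carrier V)" by (simp add: quantale_power_def)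
  have le: "u \<preceq>\<^bsub>?P\<^esub> v \<longleftrightarrow> (\<forall>i\<in>I. u i \<preceq>\<^bsub>V\<^esub> v i)" for u v by (simp add: quantale_power_def)
  have m: "u \<otimes>\<^bsub>?P\<^esub> v = (\<lambda>i\<in>I. u i \<otimes>\<^bsub>V\<^esub> v i)" for u v by (simp add: quantale_power_def)
  have one: "\<one>\<^bsub>?P\<^esub> = (\<lambda>i\<in>I. \<one>\<^bsub>V\<^esub>)" by (simp add: quantale_power_def)
  have cV: "carrier (order_of V) = carrier V" and lV: "le (order_of V) = qle V"
    by (simp_all add: order_of_def)
  have refl: "x \<in> carrier V \<Longrightarrow> x \<preceq>\<^bsub>V\<^esub> x" for x
    using order.le_refl[of x] by (simp add: cV lV)
  have antisym: "\<lbrakk>x \<in> carrier V; y \<in> carrier V; x \<preceq>\<^bsub>V\<^esub> y; y \<preceq>\<^bsub>V\<^esub> x\<rbrakk> \<Longrightarrow> x = y" for x y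
    using order.le_antisym[of x y] by (simp add: cV lV)
  have trans: "\<lbrakk>x \<in> carrier V; y \<in> carrier V; z \<in> carrier V; x \<preceq>\<^bsub>V\<^esub> y; y \<preceq>\<^bsub>V\<^esub> z\<rbrakk> \<Longrightarrow> x \<preceq>\<^bsub>V\<^esub> z" for x y z
    using order.le_trans[of x y z] by (simp add: cV lV)
  have comp: "a i \<in> carrier V" if "a \<in> carrier ?P" "i \<in> I" for a i
    using that by (auto simp: c)
  have lubI: "is_lub (order_of ?P) s A"
    if "s \<in> carrier ?P" "A \<subseteq> carrier ?P" "\<And>i. i \<in> I \<Longrightarrow> is_lub (order_of V) (s i) ((\<lambda>a. a i) ` A)" for s A
    unfolding is_lub_order_of le
  proof (intro conjI ballI impI that(1))
    fix a i assume "a \<in> A \<inter> carrier ?P" and i: "i \<in> I"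
    then show "a i \<preceq>\<^bsub>V\<^esub> s i"
      using that(3)[OF i, unfolded is_lub_order_of] comp[of a i] by blast
  next
    fix b i assume b: "b \<in> carrier ?P" "\<forall>a\<in>A \<inter> carrier ?P. \<forall>i\<in>I. a i \<preceq>\<^bsub>V\<^esub> b i" and i: "i \<in> I"
    show "s i \<preceq>\<^bsub>V\<^esub> b i"
      using that(3)[OF i, unfolded is_lub_order_of] comp[OF b(1) i] b(2) i that(2) by blast
  qed
  have glbI: "is_glb (order_of ?P) s A"
    if "s \<in> carrier ?P" "A \<subseteq> carrier ?P" "\<And>i. i \<in> I \<Longrightarrow> is_glb (order_of V) (s i) ((\<lambda>a. a i) ` A)" for s A
    unfolding is_glb_order_of le
  proof (intro conjI ballI impI that(1))
    fix a i assume "a \<in> A \<inter> carrier ?P" and i: "i \<in> I"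
    then show "s i \<preceq>\<^bsub>V\<^esub> a i"
      using that(3)[OF i, unfolded is_glb_order_of] comp[of a i] by blast
  next
    fix b i assume b: "b \<in> carrier ?P" "\<forall>a\<in>A \<inter> carrier ?P. \<forall>i\<in>I. b i \<preceq>\<^bsub>V\<^esub> a i" and i: "i \<in> I"
    show "b i \<preceq>\<^bsub>V\<^esub> s i"
      using that(3)[OF i, unfolded is_glb_order_of] comp[OF b(1) i] b(2) i that(2) by blast
  qed
  have lub_pointwise: "\<exists>s \<in> carrier ?P. \<forall>i\<in>I. is_lub (order_of V) (s i) ((\<lambda>a. a i) ` A)"
    if "A \<subseteq> carrier ?P" for A
  proof -
    have "\<forall>i\<in>I. \<exists>s. is_lub (order_of V) s ((\<lambda>a. a i) ` A)"
      using that by (intro ballI order.sup_exists) (auto simp: c cV)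
    then obtain f where "\<forall>i\<in>I. is_lub (order_of V) (f i) ((\<lambda>a. a i) ` A)" by metis
    then show ?thesis
      by (intro bexI[of _ "restrict f I"]) (auto simp: c is_lub_order_of)
  qed
  have lub: "\<exists>s. is_lub (order_of ?P) s A" if "A \<subseteq> carrier ?P" for A
    using lub_pointwise[OF that] lubI[OF _ that] by blast
  have glb: "\<exists>s. is_glb (order_of ?P) s A" if "A \<subseteq> carrier ?P" for A
  proof -
    have "\<forall>i\<in>I. \<exists>s. is_glb (order_of V) s ((\<lambda>a. a i) ` A)"
      using that by (intro ballI order.inf_exists) (auto simp: c cV)
    then obtain f where f: "\<forall>i\<in>I. is_glb (order_of V) (f i) ((\<lambda>a. a i) ` A)" by metis
    then show ?thesis
      by (intro exI[of _ "restrict f I"] glbI that) (auto simp: c is_glb_order_of)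
  qed
  have antisymP: "x = y" if "x \<in> carrier ?P" "y \<in> carrier ?P" "x \<preceq>\<^bsub>?P\<^esub> y" "y \<preceq>\<^bsub>?P\<^esub> x" for x y
    using that unfolding c le by (intro PiE_ext[of x I _ y]) (auto intro!: antisym dest: PiE_mem)
  have lubD: "is_lub (order_of V) (s i) ((\<lambda>a. a i) ` A)"
    if "A \<subseteq> carrier ?P" "is_lub (order_of ?P) s A" "i \<in> I" for s A i
  proof -
    obtain t where t: "t \<in> carrier ?P" "\<forall>i\<in>I. is_lub (order_of V) (t i) ((\<lambda>a. a i) ` A)"
      using lub_pointwise[OF \<open>A \<subseteq> carrier ?P\<close>] by blast
    then have "is_lub (order_of ?P) t A" using lubI that(1) by blast
    with that(2) have "s = t"
      unfolding is_lub_order_of by (intro antisymP) auto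
    with t that(3) show ?thesis by simp
  qed
  show ?thesis
  proof (rule quantaleI)
    show "monoid ?P"
      by unfold_locales (auto simp: c m one PiE_def Pi_def extensional_def fun_eq_iff m_assoc)
    show "\<And>x. x \<in> carrier ?P \<Longrightarrow> x \<preceq>\<^bsub>?P\<^esub> x"
      by (auto simp: c le intro!: refl)
    show "\<And>x y z. \<lbrakk>x \<in> carrier ?P; y \<in> carrier ?P; z \<in> carrier ?P; x \<preceq>\<^bsub>?P\<^esub> y; y \<preceq>\<^bsub>?P\<^esub> z\<rbrakk> \<Longrightarrow> x \<preceq>\<^bsub>?P\<^esub> z"
      unfolding c le by (meson PiE_mem trans)
    fix x A s
    assume x: "x \<in> carrier ?P" and A: "A \<subseteq> carrier ?P" and s: "is_lub (order_of ?P) s A"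
    have sc: "s \<in> carrier ?P" using s by (simp add: is_lub_order_of)
    have Ai: "(\<lambda>a. a i) ` A \<subseteq> carrier V" if "i \<in> I" for i
      using A that by (auto simp: c)
    have mc: "y \<otimes>\<^bsub>?P\<^esub> z \<in> carrier ?P" if "y \<in> carrier ?P" "z \<in> carrier ?P" for y z
      unfolding c m using comp[OF that(1)] comp[OF that(2)] by auto
    have xi: "x i \<in> carrier V" if "i \<in> I" for i using x that by (auto simp: c)
    show "is_lub (order_of ?P) (x \<otimes>\<^bsub>?P\<^esub> s) ((\<lambda>a. x \<otimes>\<^bsub>?P\<^esub> a) ` A)"
    proof (rule lubI)
      fix i assume i: "i \<in> I"
      show "is_lub (order_of V) ((x \<otimes>\<^bsub>?P\<^esub> s) i) ((\<lambda>a. a i) ` (\<lambda>a. x \<otimes>\<^bsub>?P\<^esub> a) ` A)"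
        using mult_lub_left[OF xi[OF i] Ai[OF i] lubD[OF A s i]] i by (simp add: m image_image)
    qed (use x sc A in \<open>auto intro!: mc\<close>)
    show "is_lub (order_of ?P) (s \<otimes>\<^bsub>?P\<^esub> x) ((\<lambda>a. a \<otimes>\<^bsub>?P\<^esub> x) ` A)"
    proof (rule lubI)
      fix i assume i: "i \<in> I"
      show "is_lub (order_of V) ((s \<otimes>\<^bsub>?P\<^esub> x) i) ((\<lambda>a. a i) ` (\<lambda>a. a \<otimes>\<^bsub>?P\<^esub> x) ` A)"
        using mult_lub_right[OF xi[OF i] Ai[OF i] lubD[OF A s i]] i by (simp add: m image_image)
    qed (use x sc A in \<open>auto intro!: mc\<close>)
  qed (fact lub glb antisymP)+
qed

end

(* Every triple with w \<le> u + v arises as the three distances of an extended quasi-pseudometric on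
   three points: asymmetry and the value \<open>\<infinity>\<close> allow all the remaining distances to be
   infinite. Testing an aggregation function on such spaces therefore gives preservation of
   asymmetric triangle triplets. Conversely, monotonicity of F is preservation of the triplets
   (u, 0, v) with v \<le> u. *)

theory Submission
  imports Defs
begin

text \<open>Here \<open>c\<close> is the intermediate point: \<open>u\<close> and \<open>v\<close>
  are the legs of the route from \<open>a\<close> through \<open>c\<close> to \<open>b\<close>, and
  \<open>w\<close> is the direct distance.\<close>

definition three_point_dist :: "'a \<Rightarrow> 'a \<Rightarrow> 'a \<Rightarrow> ennreal \<Rightarrow> ennreal \<Rightarrow> ennreal \<Rightarrow> 'a \<Rightarrow> 'a \<Rightarrow> ennreal" where
  "three_point_dist a b c u v w x y =
     (if x = y then 0 else if x = a \<and> y = c then u else if x = c \<and> y = b then v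
      else if x = a \<and> y = b then w else \<infinity>)"

text \<open>Among distinct points only the steps from a to c, c to b and a to b can be finite. The
  only two of them that compose are a to c and c to b, so the one triangle inequality with content
  is w \<le> u + v.\<close>

lemma ext_quasi_pseudometric_three_point_dist:
  assumes "distinct [a, b, c]" and "w \<le> u + v"
  shows "ext_quasi_pseudometric {a, b, c} (three_point_dist a b c u v w)"
  using assms by (auto simp: ext_quasi_pseudometric_def three_point_dist_def)

text \<open>Restricting arbitrary functions replaces the carrier conditions, so the criterion
  applies directly to families of distances that need not be extensional.\<close>

lemma preserves_asymmetric_triangle_triplets_P_plus:
  "preserves_asymmetric_triangle_triplets (quantale_power P\<^sub>+ I) P\<^sub>+ F \<longleftrightarrow>
     (\<forall>u v w. (\<forall>i\<in>I. w i \<le> u i + v i) \<longrightarrow>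
        F (restrict w I) \<le> F (restrict u I) + F (restrict v I))"
  (is "?L \<longleftrightarrow> ?R")
proof
  assume L: ?L
  show ?R
  proof (intro allI impI)
    fix u v w :: "'a \<Rightarrow> ennreal"
    assume "\<forall>i\<in>I. w i \<le> u i + v i"
    then have "asymmetric_triangle_triplet (quantale_power P\<^sub>+ I)
        (restrict u I) (restrict v I) (restrict w I)"
      by (simp add: asymmetric_triangle_triplet_def quantale_power_def P_plus_def)
    with L show "F (restrict w I) \<le> F (restrict u I) + F (restrict v I)"
      by (force simp: preserves_asymmetric_triangle_triplets_def asymmetric_triangle_triplet_def
          P_plus_def)
  qed
next
  assume R: ?R
  show ?L
    unfolding preserves_asymmetric_triangle_triplets_def
  proof (intro allI impI)
    fix u v w
    assume t: "asymmetric_triangle_triplet (quantale_power P\<^sub>+ I) u v w"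
    then have "restrict u I = u" "restrict v I = v" "restrict w I = w"
      by (auto simp: asymmetric_triangle_triplet_def quantale_power_def PiE_def extensional_restrict)
    moreover have "\<forall>i\<in>I. w i \<le> u i + v i"
      using t by (simp add: asymmetric_triangle_triplet_def quantale_power_def P_plus_def)
    ultimately have "F w \<le> F u + F v"
      using R by metis
    then show "asymmetric_triangle_triplet P\<^sub>+ (F u) (F v) (F w)"
      by (simp add: asymmetric_triangle_triplet_def P_plus_def)
  qed
qed

lemma lax_morphism_P_plus_iff:
  "lax_morphism (quantale_power P\<^sub>+ I) P\<^sub>+ F \<longleftrightarrow>
     preserves_asymmetric_triangle_triplets (quantale_power P\<^sub>+ I) P\<^sub>+ F \<and> F (\<lambda>i\<in>I. 0) = 0"
  (is "?L \<longleftrightarrow> ?R")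
proof
  assume ?L
  then interpret lax_morphism "quantale_power P\<^sub>+ I" "P\<^sub>+" F .
  have "F (restrict w I) \<le> F (restrict u I) + F (restrict v I)" if "\<forall>i\<in>I. w i \<le> u i + v i" for u v w
  proof -
    have "F (restrict w I) \<le> F (\<lambda>i\<in>I. u i + v i)"
      using mono[of "\<lambda>i\<in>I. u i + v i" "restrict w I"] that
      by (simp add: quantale_power_def P_plus_def)
    also have "(\<lambda>i\<in>I. u i + v i) = restrict u I \<otimes>\<^bsub>quantale_power P\<^sub>+ I\<^esub> restrict v I"
      by (auto simp: quantale_power_def P_plus_def)
    also have "F \<dots> \<le> F (restrict u I) + F (restrict v I)"
      using lax_mult[of "restrict u I" "restrict v I"]
      by (simp add: quantale_power_def P_plus_def)
    finally show ?thesis .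
  qed
  \<comment> \<open>The order of \<open>P\<^sub>+\<close> is reversed, so \<open>lax_one\<close>
    bounds F at the zero family above by 0, which forces equality.\<close>
  then show ?R
    using lax_one unfolding preserves_asymmetric_triangle_triplets_P_plus
    by (auto simp: quantale_power_def P_plus_def)
next
  assume R: ?R
  then have zero: "F (\<lambda>i\<in>I. 0) = 0"
    and tri: "\<And>u v w. asymmetric_triangle_triplet (quantale_power P\<^sub>+ I) u v w \<Longrightarrow> F w \<le> F u + F v"
    by (auto simp: preserves_asymmetric_triangle_triplets_def asymmetric_triangle_triplet_def
        P_plus_def)
  interpret V: quantale "quantale_power P\<^sub>+ I"
    by (rule quantale_quantale_power[OF quantale_P_plus])
  interpret W: quantale "P\<^sub>+"
    by (rule quantale_P_plus)
  show ?L
  proof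
    fix u v
    assume u: "u \<in> carrier (quantale_power P\<^sub>+ I)" and v: "v \<in> carrier (quantale_power P\<^sub>+ I)"
    \<comment> \<open>In the usual order the premise is v \<le> u pointwise; \<open>zero\<close>
      removes the middle term from the bound given by the triplet.\<close>
    show "F u \<preceq>\<^bsub>P\<^sub>+\<^esub> F v" if "u \<preceq>\<^bsub>quantale_power P\<^sub>+ I\<^esub> v"
      using tri[of u "\<lambda>i\<in>I. 0" v] zero u v that
      by (simp add: asymmetric_triangle_triplet_def quantale_power_def P_plus_def)
    \<comment> \<open>The triplet whose third member is the sum itself, where equality
      holds.\<close>
    show "F u \<otimes>\<^bsub>P\<^sub>+\<^esub> F v \<preceq>\<^bsub>P\<^sub>+\<^esub> F (u \<otimes>\<^bsub>quantale_power P\<^sub>+ I\<^esub> v)"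
      using tri[of u v "u \<otimes>\<^bsub>quantale_power P\<^sub>+ I\<^esub> v"] u v
      by (simp add: asymmetric_triangle_triplet_def quantale_power_def P_plus_def)
  qed (use zero in \<open>auto simp: quantale_power_def P_plus_def\<close>)
qed

text \<open>The three points of the universe carry the test spaces. Conversely, the distances
  between three points of the product form a triplet in each coordinate.\<close>

lemma aggregation_on_products_iff:
  assumes "\<exists>a b c :: 'a. distinct [a, b, c]"
  shows "aggregation_on_products TYPE('a) I F \<longleftrightarrow>
     preserves_asymmetric_triangle_triplets (quantale_power P\<^sub>+ I) P\<^sub>+ F \<and> F (\<lambda>i\<in>I. 0) = 0"
  (is "?L \<longleftrightarrow> ?R")
proof
  assume L: ?L
  from assms obtain a b c :: 'a where abc: "distinct [a, b, c]" by blast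
  have *: "F (restrict w I) \<le> F (restrict u I) + F (restrict v I) \<and> F (\<lambda>i\<in>I. 0) = 0"
    if "\<forall>i\<in>I. w i \<le> u i + v i" for u v w
  proof -
    let ?d = "\<lambda>i. three_point_dist a b c (u i) (v i) (w i)"
    have Q: "ext_quasi_pseudometric (\<Pi>\<^sub>E i\<in>I. {a, b, c}) (\<lambda>x y. F (\<lambda>i\<in>I. ?d i (x i) (y i)))"
      using that L[unfolded aggregation_on_products_def, rule_format, of "\<lambda>_. {a, b, c}" ?d]
        ext_quasi_pseudometric_three_point_dist[OF abc] by blast
    \<comment> \<open>Every factor is the same three-point set; at constant points of the product
      all coordinates are tested at the same pair.\<close>
    have d: "(\<lambda>i\<in>I. ?d i ((\<lambda>i\<in>I. p) i) ((\<lambda>i\<in>I. q) i)) = (\<lambda>i\<in>I. ?d i p q)" for p q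
      by auto
    let ?E = "\<lambda>p q. F (\<lambda>i\<in>I. ?d i p q)"
    have mem: "(\<lambda>i\<in>I. p) \<in> (\<Pi>\<^sub>E i\<in>I. {a, b, c})" if "p \<in> {a, b, c}" for p
      using that by auto
    have "?E a b \<le> ?E a c + ?E c b"
      using Q[unfolded ext_quasi_pseudometric_def, THEN conjunct2, THEN conjunct2, rule_format,
          OF mem mem mem, of a b c, unfolded d] by blast
    moreover have "?E a a = 0"
      using Q[unfolded ext_quasi_pseudometric_def, THEN conjunct2, THEN conjunct1, rule_format,
          OF mem, of a, unfolded d] by blast
    ultimately show ?thesis using abc by (auto simp: three_point_dist_def)
  qed
  \<comment> \<open>The value of F at the zero family was obtained only in the presence of some
    triplet; the zero triplet supplies one.\<close>
  from *[of "\<lambda>_. 0" "\<lambda>_. 0" "\<lambda>_. 0"] * show ?R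
    by (simp add: preserves_asymmetric_triangle_triplets_P_plus)
next
  assume ?R
  then have zero: "F (\<lambda>i\<in>I. 0) = 0"
    and tri: "\<And>u v w. \<forall>i\<in>I. w i \<le> u i + v i \<Longrightarrow>
      F (restrict w I) \<le> F (restrict u I) + F (restrict v I)"
    by (auto simp: preserves_asymmetric_triangle_triplets_P_plus)
  show ?L
    unfolding aggregation_on_products_def
  proof (intro allI impI)
    fix X :: "'b \<Rightarrow> 'a set" and d
    assume q: "\<forall>i\<in>I. ext_quasi_pseudometric (X i) (d i)"
    then have diag: "(\<lambda>i\<in>I. d i (x i) (x i)) = (\<lambda>i\<in>I. 0)" if "x \<in> (\<Pi>\<^sub>E i\<in>I. X i)" for x
      using that by (intro restrict_ext) (auto simp: ext_quasi_pseudometric_def dest: PiE_mem)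
    show "ext_quasi_pseudometric (\<Pi>\<^sub>E i\<in>I. X i) (\<lambda>x y. F (\<lambda>i\<in>I. d i (x i) (y i)))"
      unfolding ext_quasi_pseudometric_def
    proof (intro conjI ballI)
      \<comment> \<open>All factors are nonempty, so by choice the product is too, for any index
        set.\<close>
      show "(\<Pi>\<^sub>E i\<in>I. X i) \<noteq> {}"
        using q by (simp add: PiE_eq_empty_iff ext_quasi_pseudometric_def)
    next
      fix x y z
      assume "x \<in> (\<Pi>\<^sub>E i\<in>I. X i)" "y \<in> (\<Pi>\<^sub>E i\<in>I. X i)" "z \<in> (\<Pi>\<^sub>E i\<in>I. X i)"
      with q show "F (\<lambda>i\<in>I. d i (x i) (y i)) \<le> F (\<lambda>i\<in>I. d i (x i) (z i)) + F (\<lambda>i\<in>I. d i (z i) (y i))"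
        by (intro tri) (auto simp: ext_quasi_pseudometric_def dest!: PiE_mem)
    qed (simp add: diag zero)
  qed
qed

text \<open>The same test distances now live on one common set, so they are evaluated at a, b and c
  directly, without passing to constant points.\<close>

lemma aggregation_on_sets_iff:
  assumes "\<exists>a b c :: 'a. distinct [a, b, c]"
  shows "aggregation_on_sets TYPE('a) I F \<longleftrightarrow>
     preserves_asymmetric_triangle_triplets (quantale_power P\<^sub>+ I) P\<^sub>+ F \<and> F (\<lambda>i\<in>I. 0) = 0"
  (is "?L \<longleftrightarrow> ?R")
proof
  assume L: ?L
  from assms obtain a b c :: 'a where abc: "distinct [a, b, c]" by blast
  have *: "F (restrict w I) \<le> F (restrict u I) + F (restrict v I) \<and> F (\<lambda>i\<in>I. 0) = 0"
    if "\<forall>i\<in>I. w i \<le> u i + v i" for u v w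
  proof -
    let ?d = "\<lambda>i. three_point_dist a b c (u i) (v i) (w i)"
    have "ext_quasi_pseudometric {a, b, c} (\<lambda>x y. F (\<lambda>i\<in>I. ?d i x y))"
      using that L[unfolded aggregation_on_sets_def, rule_format, of "{a, b, c}" ?d]
        ext_quasi_pseudometric_three_point_dist[OF abc] by blast
    then have "F (\<lambda>i\<in>I. ?d i a b) \<le> F (\<lambda>i\<in>I. ?d i a c) + F (\<lambda>i\<in>I. ?d i c b)"
      "F (\<lambda>i\<in>I. ?d i a a) = 0"
      unfolding ext_quasi_pseudometric_def by blast+
    then show ?thesis using abc by (auto simp: three_point_dist_def)
  qed
  from *[of "\<lambda>_. 0" "\<lambda>_. 0" "\<lambda>_. 0"] * show ?R
    by (simp add: preserves_asymmetric_triangle_triplets_P_plus)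
next
  assume ?R
  then have zero: "F (\<lambda>i\<in>I. 0) = 0"
    and tri: "\<And>u v w. \<forall>i\<in>I. w i \<le> u i + v i \<Longrightarrow>
      F (restrict w I) \<le> F (restrict u I) + F (restrict v I)"
    by (auto simp: preserves_asymmetric_triangle_triplets_P_plus)
  show ?L
    unfolding aggregation_on_sets_def
  proof (intro allI impI)
    fix X :: "'a set" and d
    assume X: "X \<noteq> {}" and q: "\<forall>i\<in>I. ext_quasi_pseudometric X (d i)"
    then have diag: "(\<lambda>i\<in>I. d i x x) = (\<lambda>i\<in>I. 0)" if "x \<in> X" for x
      using that by (auto simp: ext_quasi_pseudometric_def)
    show "ext_quasi_pseudometric X (\<lambda>x y. F (\<lambda>i\<in>I. d i x y))"
      unfolding ext_quasi_pseudometric_def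
    proof (intro conjI ballI)
      fix x y z
      assume "x \<in> X" "y \<in> X" "z \<in> X"
      with q show "F (\<lambda>i\<in>I. d i x y) \<le> F (\<lambda>i\<in>I. d i x z) + F (\<lambda>i\<in>I. d i z y)"
        by (intro tri) (auto simp: ext_quasi_pseudometric_def)
    \<comment> \<open>An empty family carries no information about \<open>X\<close>, so nonemptiness
      comes from the assumption on the set.\<close>
    qed (simp_all add: X diag zero)
  qed
qed

text \<open>Each condition is compared with preservation of triplets, which mentions no universe of
  points; hence the two aggregation notions may range over different types.\<close>

theorem theorem3p15:
  fixes I :: "'i set" and F :: "('i \<Rightarrow> ennreal) \<Rightarrow> ennreal"
  assumes "\<exists>a b c :: 'a. distinct [a, b, c]"
    and "\<exists>a b c :: 'b. distinct [a, b, c]"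
  shows "(aggregation_on_products TYPE('a) I F \<longleftrightarrow> aggregation_on_sets TYPE('b) I F)
    \<and> (aggregation_on_sets TYPE('b) I F \<longleftrightarrow> lax_morphism (quantale_power P\<^sub>+ I) P\<^sub>+ F)
    \<and> (lax_morphism (quantale_power P\<^sub>+ I) P\<^sub>+ F \<longleftrightarrow>
         preserves_asymmetric_triangle_triplets (quantale_power P\<^sub>+ I) P\<^sub>+ F
         \<and> F (\<lambda>i\<in>I. 0) = 0)"
  by (simp add: aggregation_on_products_iff[OF assms(1)] aggregation_on_sets_iff[OF assms(2)]
      lax_morphism_P_plus_iff)

end
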